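(* Let $t$ be a positive integer and let $G$ be a finite simple connected graph with $2\le |V(G)|\le t+1$. Then \[\rho(G,K_{1,t})=\frac{t}{|V(G)|-1}.\]
   Context: $K_{1,t}$ is the star with $t$ edges. A graphon is a symmetric measurable function $W:[0,1]^2\to[0,1]$. For a finite simple graph $G$ with vertices $v_1,\dots,v_n$, put $t(G,W)=\int_{[0,1]^n}\prod_{v_iv_j\in E(G)}W(x_i,x_j)\,dx_1\cdots dx_n$; for a finite graph $W$ (loops allowed), $t(G,W)=\hom(G,W)/|V(W)|^{|V(G)|}$, where $\hom(G,W)$ is the number of maps $V(G)\to V(W)$ sending edges to edges. For finite simple graphs $G,H$, the density domination exponent is $\rho(G,H)=\sup_W \frac{\log t(H,W)}{\log t(G,W)}\in[0,\infty]$, where $W$ ranges over all graphons (equivalently, all finite graphs) with $t(G,W)\ne 0$. Conventions: those $W$ with $t(G,W)=1$, where the quotient is undefined, are omitted; $\log 0=-\infty$, so the quotient is $+\infty$ if $t(H,W)=0$. Thus, when $G$ has at least one edge, for $c>0$ one has $\rho(G,H)\le c$ if and only if $t(H,W)\ge t(G,W)^c$ for every $W$. *)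

theory Defs
  imports "HOL-Analysis.Analysis" "Graph_Theory.Kuratowski"
begin

text \<open>
  A finite simple graph is a \<^locale>\<open>pair_graph\<close>: a finite loop-free digraph without parallel arcs
  whose arc relation is symmetric. Every undirected edge $uv$ thus occurs as the two arcs
  $(u,v)$ and $(v,u)$; \<open>edges\<close> lists it once.
\<close>

definition edges :: "'a pair_pre_digraph \<Rightarrow> 'a set set" where
  "edges G = {{u, v} | u v. (u, v) \<in> parcs G}"

definition star :: "nat \<Rightarrow> nat pair_pre_digraph" where
  "star t = \<lparr>pverts = {0..t}, parcs = {0} \<times> {1..t} \<union> {1..t} \<times> {0}\<rparr>"

lemma star_complete_bipartite: "K\<^bsub>1,t\<^esub> (with_proj (star t))"
  unfolding complete_bipartite_digraph_pair_def
proof (intro conjI exI)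
  show "pverts (star t) = {0} \<union> {1..t}" by (auto simp: star_def)
  show "parcs (star t) = {0} \<times> {1..t} \<union> {1..t} \<times> {0}" by (simp add: star_def)
qed (auto simp: star_def)

text \<open>
  Only the values on the unit square matter; measurable means Lebesgue measurable.
\<close>

definition graphon :: "(real \<Rightarrow> real \<Rightarrow> real) \<Rightarrow> bool" where
  "graphon W \<longleftrightarrow>
     case_prod W \<in> borel_measurable (lebesgue_on ({0..1} \<times> {0..1})) \<and>
     (\<forall>x\<in>{0..1}. \<forall>y\<in>{0..1}. W x y = W y x \<and> 0 \<le> W x y \<and> W x y \<le> 1)"

text \<open>
  The value $W(x_u,x_v)$ at an unordered edge $e = uv$. The description is proper whenever \<open>W\<close> is
  symmetric at the points in question, see \<open>edge_weight_eq\<close>.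
\<close>

definition edge_weight :: "(real \<Rightarrow> real \<Rightarrow> real) \<Rightarrow> ('a \<Rightarrow> real) \<Rightarrow> 'a set \<Rightarrow> real" where
  "edge_weight W x e = (THE w. \<forall>u v. e = {u, v} \<longrightarrow> w = W (x u) (x v))"

lemma edge_weight_eq:
  assumes "W (x u) (x v) = W (x v) (x u)"
  shows "edge_weight W x {u, v} = W (x u) (x v)"
  unfolding edge_weight_def using assms by (intro the_equality) (auto simp: doubleton_eq_iff)

text \<open>
  The completed product measure is Lebesgue measure on $[0,1]^{V(G)}$. The completion is needed
  because \<open>W\<close> is only Lebesgue measurable.
\<close>

definition hom_density :: "'a pair_pre_digraph \<Rightarrow> (real \<Rightarrow> real \<Rightarrow> real) \<Rightarrow> real" where
  "hom_density G W =
     (LINT x | completion (\<Pi>\<^sub>M v\<in>pverts G. restrict_space lborel {0..1}).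
        (\<Prod>e\<in>edges G. edge_weight W x e))"

definition ext_ln :: "real \<Rightarrow> ereal" where
  "ext_ln x = (if x = 0 then - \<infinity> else ereal (ln x))"

lemma ext_ln_quotient:
  assumes "0 < a" "a < 1" "0 \<le> b" "b \<le> 1"
  shows "ext_ln b / ext_ln a = (if b = 0 then \<infinity> else ereal (ln b / ln a))"
    and "0 \<le> ext_ln b / ext_ln a"
proof -
  have "ln a < 0" using assms by simp
  show eq: "ext_ln b / ext_ln a = (if b = 0 then \<infinity> else ereal (ln b / ln a))"
    using \<open>ln a < 0\<close> assms by (auto simp: ext_ln_def divide_ereal_def divide_inverse)
  show "0 \<le> ext_ln b / ext_ln a"
    unfolding eq using \<open>ln a < 0\<close> assms by (auto simp: divide_nonpos_neg)
qed

text \<open>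
  The supremum is taken in $[0,\infty]$. All the quotients are nonnegative, so \<^const>\<open>e2ennreal\<close>
  only changes their type.
\<close>

definition density_domination_exponent ::
    "'a pair_pre_digraph \<Rightarrow> 'b pair_pre_digraph \<Rightarrow> ennreal" where
  "density_domination_exponent G H =
     (SUP W \<in> {W. graphon W \<and> hom_density G W \<noteq> 0 \<and> hom_density G W \<noteq> 1}.
        e2ennreal (ext_ln (hom_density H W) / ext_ln (hom_density G W)))"

end

theory Submission
  imports Defs "HOL-Probability.Infinite_Product_Measure"
begin

text \<open>
  Let $k = |V(G)| - 1$ and $d(x) = \int W(x,y)\,dy$. Since $W \le 1$, deleting edges only increases
  the density, so for the upper bound $G$ may be replaced by a spanning tree $T$ with $k$ edges. More
  generally $\int d(x_w)^s \prod_{uv \in E(T)} W(x_u,x_v) \le \int d^{k+s}$ for every vertex $w$ of $T$: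
  integrating out a leaf $v \ne w$ with neighbour $u$ produces the factor $d(x_u)$, and
  $a^s b \le (s\,a^{s+1} + b^{s+1})/(s+1)$ bounds the result by integrals of the same shape over
  $T - v$ rooted at $w$ and at $u$. With $s = 0$ and convexity of $y \mapsto y^{t/k}$ this gives
  $t(G,W)^{t/k} \le \int d^t = t(K_{1,t},W)$. Equality holds for the disjoint union of two cliques
  of measure $1/2$, where a connected graph on $n$ vertices has density $2^{1-n}$.
\<close>

subsection \<open>Spanning trees\<close>

text \<open>Trees are generated by attaching leaves because the arguments below remove one leaf at a
  time. Edges are two-element sets, matching \<open>edges\<close>.\<close>

inductive tree_on :: "'a set \<Rightarrow> 'a set set \<Rightarrow> bool" where
  single: "tree_on {r} {}"
| leaf: "tree_on V E \<Longrightarrow> u \<in> V \<Longrightarrow> v \<notin> V \<Longrightarrow> tree_on (insert v V) (insert {u, v} E)"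

lemma tree_finite: "tree_on V E \<Longrightarrow> finite V \<and> finite E"
  by (induction rule: tree_on.induct) auto

lemma tree_edgeE:
  assumes "tree_on V E" "e \<in> E"
  obtains u v where "e = {u, v}" "u \<in> V" "v \<in> V" "u \<noteq> v"
proof -
  have "\<exists>u v. e = {u, v} \<and> u \<in> V \<and> v \<in> V \<and> u \<noteq> v"
    using assms by (induction rule: tree_on.induct) blast+
  then show ?thesis using that by blast
qed

lemma tree_edge_subset: "tree_on V E \<Longrightarrow> e \<in> E \<Longrightarrow> e \<subseteq> V"
  by (auto elim: tree_edgeE)

lemma tree_card: "tree_on V E \<Longrightarrow> card V = Suc (card E)"
proof (induction rule: tree_on.induct)
  case (leaf V E u v)
  then have "{u, v} \<notin> E" using tree_edge_subset by blast
  with leaf tree_finite[OF leaf(1)] show ?case by simp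
qed simp

text \<open>A tree with more than one vertex has a leaf other than the prescribed root
  \<open>w\<close>, and removing that one keeps \<open>w\<close> available as a root. In the
  induction only the case \<open>w = v\<close>, where the root is the leaf attached last, needs
  thought: there the hypothesis is applied to the tree without \<open>w\<close>, rooted at the
  neighbour \<open>u\<close>.\<close>

lemma tree_remove_leaf:
  assumes "tree_on V E" "w \<in> V"
  obtains "V = {w}" "E = {}"
  | V' E' u v where "tree_on V' E'" "u \<in> V'" "v \<notin> V'" "w \<in> V'"
      "V = insert v V'" "E = insert {u, v} E'"
  using assms
proof (induction arbitrary: w thesis rule: tree_on.induct)
  case (leaf V E u v)
  show ?case
  proof (cases "w = v")
    case False
    then show ?thesis using leaf.hyps leaf.prems by blast
  next
    case w: True
    show ?thesis
    proof (rule leaf.IH[of u])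
      assume "V = {u}" "E = {}"
      \<comment> \<open>The whole tree is the single edge between \<open>u\<close> and
        \<open>w\<close>; the roles are exchanged and \<open>u\<close> becomes the leaf.\<close>
      with w leaf.hyps show ?thesis
        by (intro leaf.prems(2)[OF tree_on.single[of w], of w u]) (auto simp: insert_commute)
    next
      fix V' E' a b
      assume *: "tree_on V' E'" "a \<in> V'" "b \<notin> V'" "u \<in> V'" "V = insert b V'" "E = insert {a, b} E'"
      \<comment> \<open>Since \<open>b\<close> differs from \<open>u\<close>, the two attachments
        commute: \<open>v\<close> is joined to \<open>u\<close> first and \<open>b\<close> to
        \<open>a\<close> last.\<close>
      show ?thesis
        by (rule leaf.prems(2)[OF tree_on.leaf[OF *(1) *(4), of v], of a b])
          (use * w leaf.hyps in \<open>auto simp: insert_commute\<close>)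
    qed (use leaf in auto)
  qed
qed blast

text \<open>Each new leaf inherits the value of its neighbour. Applied to a spanning tree, this is
  how connectedness enters the clique example.\<close>

lemma tree_eq_const:
  assumes "tree_on V E" "\<And>u v. {u, v} \<in> E \<Longrightarrow> P u = P v"
  shows "\<exists>c. \<forall>v\<in>V. P v = c"
  using assms
proof (induction rule: tree_on.induct)
  case (leaf V E u v)
  then obtain c where "\<forall>v\<in>V. P v = c" by auto
  moreover have "P u = P v" using leaf.prems by blast
  ultimately show ?case using leaf.hyps by auto
qed simp

section \<open>Edge sets of graphs, spanning trees and the star\<close>

lemma edgesE:
  assumes "pair_graph G" "e \<in> edges G"
  obtains u v where "e = {u, v}" "u \<in> pverts G" "v \<in> pverts G" "u \<noteq> v"
proof -
  interpret pair_graph G by fact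
  obtain u v where uv: "e = {u, v}" "(u, v) \<in> parcs G"
    using assms(2) unfolding edges_def by blast
  show ?thesis
  proof (rule that[OF uv(1)])
    show "u \<in> pverts G" "v \<in> pverts G" using arc_fst_in_verts arc_snd_in_verts uv(2) by fastforce+
    show "u \<noteq> v" using no_loops[OF uv(2)] by simp
  qed
qed

lemma finite_edges:
  assumes "pair_graph G"
  shows "finite (edges G)"
proof -
  interpret pair_graph G by fact
  have "edges G = (\<lambda>(u, v). {u, v}) ` parcs G" by (auto simp: edges_def)
  then show ?thesis by simp
qed

text \<open>A subtree whose vertex set is maximal among those containing a fixed vertex
  \<open>r\<close> must span: a walk from \<open>r\<close> that left it would supply an edge to a
  new leaf.\<close>

lemma spanning_tree_exists:
  assumes G: "pair_graph G" and con: "Digraph_Component.connected (with_proj G)"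
  obtains E where "tree_on (pverts G) E" "E \<subseteq> edges G"
proof -
  interpret pair_graph G by fact
  \<comment> \<open>Connectedness refers to the symmetric closure. The arcs of a pair graph are
    symmetric already, so reachability there is reachability along \<open>parcs G\<close>.\<close>
  have par: "parcs (mk_symmetric (with_proj G)) = parcs G"
    using adj_mk_symmetric_eq sym_arcs by simp
  obtain r where r: "r \<in> pverts G"
    using con by (auto simp: Digraph_Component.connected_def strongly_connected_def)
  define T where "T = {S. S \<subseteq> pverts G \<and> r \<in> S \<and> (\<exists>E \<subseteq> edges G. tree_on S E)}"
  have "{r} \<in> T" using r tree_on.single[of r] by (auto simp: T_def)
  moreover have "finite T" by (rule finite_subset[of _ "Pow (pverts G)"]) (auto simp: T_def)
  ultimately obtain S where S: "S \<in> T" and max: "\<And>S'. S' \<in> T \<Longrightarrow> S \<subseteq> S' \<Longrightarrow> S = S'"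
    using finite_has_maximal[of T] by blast
  have "z \<in> S" if z: "z \<in> pverts G" for z
  proof -
    have "(r, z) \<in> rtrancl_on (pverts G) (parcs G)"
      using con r z by (auto simp: Digraph_Component.connected_def strongly_connected_def reachable_def par)
    then show ?thesis
    proof (induction rule: rtrancl_on_induct)
      case base
      then show ?case using S by (auto simp: T_def)
    next
      case (step y z)
      show ?case
      proof (rule ccontr)
        assume "z \<notin> S"
        obtain E where "E \<subseteq> edges G" "tree_on S E" using S by (auto simp: T_def)
        then have "tree_on (insert z S) (insert {y, z} E)" "insert {y, z} E \<subseteq> edges G"
          using step \<open>z \<notin> S\<close> by (auto intro: tree_on.leaf simp: edges_def)
        then have "insert z S \<in> T" using S step unfolding T_def by blast
        with max[of "insert z S"] \<open>z \<notin> S\<close> show False by blast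
      qed
    qed
  qed
  then have "S = pverts G" using S by (auto simp: T_def)
  then show ?thesis using S that by (auto simp: T_def)
qed

lemma edges_star: "edges (star t) = (\<lambda>i. {0, i}) ` {1..t}"
  by (force simp: edges_def star_def)

lemma tree_star: "tree_on {0..t::nat} ((\<lambda>i. {0, i}) ` {1..t})"
proof (induction t)
  case 0
  then show ?case using tree_on.single[of "0::nat"] by simp
next
  case (Suc t)
  from tree_on.leaf[OF this, of 0 "Suc t"] show ?case
    by (simp add: atLeast0_atMost_Suc atLeastAtMostSuc_conv insert_commute)
qed

subsection \<open>Two inequalities for powers\<close>

text \<open>Weighted AM-GM for \<open>a ^ Suc s\<close> and \<open>b ^ Suc s\<close> with weights
  \<open>s\<close> and 1, cleared of denominators.\<close>

lemma power_mult_le_sum_powers: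
  fixes a b :: real
  assumes "0 \<le> a" "0 \<le> b"
  shows "real (Suc s) * (a ^ s * b) \<le> real s * a ^ Suc s + b ^ Suc s"
proof (induction s)
  case (Suc s)
  \<comment> \<open>The gap between the two sides at \<open>Suc s\<close> is \<open>b\<close> times
    the gap at \<open>s\<close> plus a nonnegative multiple of a square, so nonnegativity
    propagates.\<close>
  have "real (Suc s) * a ^ Suc (Suc s) + b ^ Suc (Suc s) - real (Suc (Suc s)) * (a ^ Suc s * b)
      = b * (real s * a ^ Suc s + b ^ Suc s - real (Suc s) * (a ^ s * b))
        + real (Suc s) * a ^ s * (a - b)\<^sup>2"
    by (simp add: algebra_simps power2_eq_square)
  moreover have "\<dots> \<ge> 0" using Suc assms by (intro add_nonneg_nonneg mult_nonneg_nonneg) auto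
  ultimately show ?case by linarith
qed simp

text \<open>Convexity of \<open>x powr p\<close>: the bound is its tangent at 1. The tangent
  argument runs on the open half-line, so 0 is separate; there the claim is
  \<open>1 - p \<le> 0\<close>.\<close>

lemma powr_ge_tangent:
  fixes y p :: real
  assumes "0 \<le> y" "1 \<le> p"
  shows "1 + p * (y - 1) \<le> y powr p"
proof (cases "y = 0")
  case False
  have "convex_on {0<..} (\<lambda>x. x powr p)" using powr_convex[OF assms(2)] by (rule convex_on_subset) auto
  moreover have "((\<lambda>x. x powr p) has_real_derivative p) (at 1 within {0<..})"
    by (auto intro!: derivative_eq_intros)
  ultimately have "y powr p - 1 powr p \<ge> p * (y - 1)"
    using False assms by (intro convex_on_imp_above_tangent[of "{0<..}"]) (auto simp: interior_open)
  then show ?thesis by simp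
qed (use assms in auto)

text \<open>Jensen's inequality for the exponent \<open>t / k\<close> and the variable
  \<open>d x ^ k\<close>, obtained by integrating the tangent at the mean. Positivity of the mean
  allows dividing by it.\<close>

lemma (in prob_space) expectation_power_mono:
  assumes meas: "d \<in> borel_measurable M" and bd: "\<And>x. 0 \<le> d x" "\<And>x. d x \<le> (1::real)"
    and "0 < k" "k \<le> (t::nat)" and pos: "0 < expectation (\<lambda>x. d x ^ k)"
  shows "expectation (\<lambda>x. d x ^ k) powr (t / k) \<le> expectation (\<lambda>x. d x ^ t)"
proof -
  let ?a = "expectation (\<lambda>x. d x ^ k)" and ?p = "t / k :: real"
  have int: "integrable M (\<lambda>x. d x ^ n)" for n
    using bd by (intro integrable_const_bound[where B=1]) (auto intro: power_le_one meas borel_measurable_power)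
  \<comment> \<open>The variable \<open>d x ^ k / ?a\<close> has mean 1, so the linear term
    integrates to zero.\<close>
  have "?a powr ?p = expectation (\<lambda>x. ?a powr ?p * (1 + ?p * (d x ^ k / ?a - 1)))"
    using pos int by (simp add: prob_space)
  also have "\<dots> \<le> expectation (\<lambda>x. d x ^ t)"
  proof (rule integral_mono)
    fix x
    have "?a powr ?p * (1 + ?p * (d x ^ k / ?a - 1)) \<le> ?a powr ?p * (d x ^ k / ?a) powr ?p"
      using bd pos assms by (intro mult_left_mono powr_ge_tangent) auto
    also have "\<dots> = (d x ^ k) powr ?p"
      using pos bd by (simp add: powr_divide)
    also have "\<dots> = d x ^ t"
    \<comment> \<open>At \<open>d x = 0\<close> both sides vanish, since \<open>0 powr ?p\<close> is
      0 and \<open>t\<close> is positive.\<close>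
    proof (cases "d x = 0")
      case False
      then have "d x > 0" using bd[of x] by simp
      then show ?thesis using \<open>0 < k\<close> by (simp add: powr_powr flip: powr_realpow)
    qed (use assms in \<open>auto simp: power_0_left\<close>)
    finally show "?a powr ?p * (1 + ?p * (d x ^ k / ?a - 1)) \<le> d x ^ t" .
  qed (use int in auto)
  finally show ?thesis .
qed

subsection \<open>Integrating out leaves\<close>

text \<open>A graphon in its most convenient form: measurable for the product sigma-algebra, with
  symmetry and bounds at all real points, so that pointwise estimates carry no side
  conditions.\<close>

locale symmetric_kernel = prob_space M for M :: "real measure" +
  fixes U :: "real \<Rightarrow> real \<Rightarrow> real"
  assumes kernel_measurable: "case_prod U \<in> borel_measurable (M \<Otimes>\<^sub>M M)"
    and kernel_sym: "U x y = U y x"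
    and kernel_nonneg: "0 \<le> U x y"
    and kernel_le_1: "U x y \<le> 1"
begin

sublocale product_sigma_finite "\<lambda>_. M" by unfold_locales

abbreviation prod_space :: "'i set \<Rightarrow> ('i \<Rightarrow> real) measure" where
  "prod_space V \<equiv> Pi\<^sub>M V (\<lambda>_. M)"

lemma prob_space_prod_space: "prob_space (prod_space V)"
  by (intro prob_space_PiM prob_space_axioms)

definition deg :: "real \<Rightarrow> real" where
  "deg x = (LINT y | M. U x y)"

definition edge_prod :: "'i set set \<Rightarrow> ('i \<Rightarrow> real) \<Rightarrow> real" where
  "edge_prod E x = (\<Prod>e\<in>E. edge_weight U x e)"

lemma edge_weight_kernel: "edge_weight U x {u, v} = U (x u) (x v)"
  by (rule edge_weight_eq) (rule kernel_sym)

lemma kernel_measurable' [measurable (raw)]: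
  assumes "f \<in> N \<rightarrow>\<^sub>M M" "g \<in> N \<rightarrow>\<^sub>M M"
  shows "(\<lambda>x. U (f x) (g x)) \<in> borel_measurable N"
  using measurable_compose[OF measurable_Pair[OF assms] kernel_measurable] by simp

lemma deg_measurable [measurable]: "deg \<in> borel_measurable M"
  unfolding deg_def by measurable

lemma deg_nonneg: "0 \<le> deg x"
  unfolding deg_def by (intro integral_nonneg_AE) (simp add: kernel_nonneg)

lemma deg_le_1: "deg x \<le> 1"
\<comment> \<open>For \<open>x\<close> outside the space of \<open>M\<close> the section
  \<open>U x\<close> may fail to be measurable; its integral is then 0 by convention.\<close>
proof (cases "integrable M (U x)")
  case True
  then show ?thesis unfolding deg_def by (intro integral_le_const) (auto simp: kernel_le_1)
qed (simp add: deg_def not_integrable_integral_eq)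

lemma edge_prod_bounds:
  assumes "\<And>e. e \<in> E \<Longrightarrow> \<exists>u v. e = {u, v}"
  shows "0 \<le> edge_prod E x \<and> edge_prod E x \<le> 1"
proof -
  have "0 \<le> edge_weight U x e \<and> edge_weight U x e \<le> 1" if "e \<in> E" for e
    using assms[OF that] kernel_nonneg kernel_le_1 by (auto simp: edge_weight_kernel)
  then show ?thesis unfolding edge_prod_def by (auto intro: prod_nonneg prod_le_1)
qed

lemma edge_prod_measurable:
  assumes "\<And>e. e \<in> E \<Longrightarrow> \<exists>u\<in>V. \<exists>v\<in>V. e = {u, v}"
  shows "edge_prod E \<in> borel_measurable (prod_space V)"
  unfolding edge_prod_def
proof (rule borel_measurable_prod)
  fix e assume "e \<in> E"
  then obtain u v where "u \<in> V" "v \<in> V" "e = {u, v}" using assms by blast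
  then show "(\<lambda>x. edge_weight U x e) \<in> borel_measurable (prod_space V)"
    unfolding \<open>e = _\<close> edge_weight_kernel by measurable
qed

lemma integrable_prod_space:
  fixes f :: "('i \<Rightarrow> real) \<Rightarrow> real"
  assumes "f \<in> borel_measurable (prod_space V)" "\<And>x. 0 \<le> f x" "\<And>x. f x \<le> 1"
  shows "integrable (prod_space V) f"
proof -
  interpret P: prob_space "prod_space V" by (rule prob_space_prod_space)
  show ?thesis using assms by (intro P.integrable_const_bound[where B = 1]) auto
qed

text \<open>Fubini: the coordinate \<open>v\<close> enters only through
  \<open>U (x u) (x v)\<close>, because \<open>f\<close> ignores it, and integrating that factor
  over \<open>x v\<close> gives the degree at \<open>x u\<close>.\<close>

lemma integrate_out_leaf:
  fixes f :: "('i \<Rightarrow> real) \<Rightarrow> real"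
  assumes V: "finite V" "u \<in> V" "v \<notin> V"
    and f: "f \<in> borel_measurable (prod_space (insert v V))" "\<And>x. 0 \<le> f x" "\<And>x. f x \<le> 1"
    and indep: "\<And>x y. f (x(v := y)) = f x"
  shows "(LINT x | prod_space (insert v V). f x * U (x u) (x v))
       = (LINT x | prod_space V. f x * deg (x u))"
proof -
  have "(LINT x | prod_space (insert v V). f x * U (x u) (x v))
      = (LINT x | prod_space V. LINT y | M. f (x(v := y)) * U ((x(v := y)) u) ((x(v := y)) v))"
  proof (rule product_integral_insert)
    show "integrable (prod_space (insert v V)) (\<lambda>x. f x * U (x u) (x v))"
    proof (rule integrable_prod_space)
      have [measurable]: "u \<in> insert v V" "v \<in> insert v V" using V by auto
      show "(\<lambda>x. f x * U (x u) (x v)) \<in> borel_measurable (prod_space (insert v V))"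
        using f(1) V by measurable
    qed (auto simp: f kernel_nonneg kernel_le_1 intro: mult_le_one)
  qed (use V in auto)
  also have "\<dots> = (LINT x | prod_space V. f x * deg (x u))"
  proof -
    have "u \<noteq> v" using V by blast
    then show ?thesis by (simp add: indep deg_def)
  qed
  finally show ?thesis .
qed

text \<open>The strengthened quantity of the induction. Removing a leaf will raise \<open>s\<close>
  by one at some root, so \<open>card E + s\<close> is preserved; \<open>s = 0\<close> is the tree
  density.\<close>

definition rooted_integral :: "'i set \<Rightarrow> 'i set set \<Rightarrow> 'i \<Rightarrow> nat \<Rightarrow> real" where
  "rooted_integral V E w s = (LINT x | prod_space V. deg (x w) ^ s * edge_prod E x)"

lemma rooted_integral_singleton: "rooted_integral {w} {} w s = expectation (\<lambda>x. deg x ^ s)"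
  unfolding rooted_integral_def edge_prod_def
  by (simp add: product_integral_singleton[of "\<lambda>x. deg x ^ s" w])

lemma tree_edge_prod_bounds:
  assumes "tree_on V E"
  shows "0 \<le> edge_prod E x" "edge_prod E x \<le> 1"
proof -
  have "\<exists>u v. e = {u, v}" if "e \<in> E" for e using tree_edgeE[OF assms that] by blast
  then show "0 \<le> edge_prod E x" "edge_prod E x \<le> 1" using edge_prod_bounds by blast+
qed

lemma tree_edge_prod_measurable:
  assumes "tree_on V E" "V \<subseteq> V'"
  shows "edge_prod E \<in> borel_measurable (prod_space V')"
  using assms by (intro edge_prod_measurable) (blast elim: tree_edgeE)

lemma rooted_integrable:
  assumes "tree_on V E" "w \<in> V"
  shows "integrable (prod_space V) (\<lambda>x. deg (x w) ^ s * edge_prod E x)"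
proof (rule integrable_prod_space)
  have [measurable]: "edge_prod E \<in> borel_measurable (prod_space V)"
    using assms(1) by (rule tree_edge_prod_measurable) simp
  show "(\<lambda>x. deg (x w) ^ s * edge_prod E x) \<in> borel_measurable (prod_space V)"
    using assms(2) by measurable
qed (auto intro!: mult_nonneg_nonneg mult_le_one power_le_one
    simp: deg_nonneg deg_le_1 tree_edge_prod_bounds[OF assms(1)])

text \<open>The edge at the leaf is new because \<open>v\<close> lies outside \<open>V\<close>, so
  its factor splits off. The remaining factors use only coordinates in \<open>V\<close>, including
  the root \<open>w\<close>, hence do not see \<open>x v\<close>.\<close>

lemma rooted_integral_leaf:
  assumes T: "tree_on V E" and V: "u \<in> V" "v \<notin> V" "w \<in> V"
  shows "rooted_integral (insert v V) (insert {u, v} E) w s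
       = (LINT x | prod_space V. deg (x w) ^ s * edge_prod E x * deg (x u))"
proof -
  have fin: "finite V" "finite E" using tree_finite[OF T] by auto
  have new: "{u, v} \<notin> E" using tree_edge_subset[OF T] V by blast
  have [measurable]: "edge_prod E \<in> borel_measurable (prod_space (insert v V))"
    using T by (rule tree_edge_prod_measurable) blast
  have indep: "edge_prod E (x(v := y)) = edge_prod E x" for x y
    unfolding edge_prod_def
  proof (rule prod.cong[OF refl])
    fix e assume "e \<in> E"
    then obtain a b where "e = {a, b}" "a \<in> V" "b \<in> V" using tree_edgeE[OF T] by metis
    then show "edge_weight U (x(v := y)) e = edge_weight U x e"
      using V by (auto simp: edge_weight_kernel)
  qed
  have "rooted_integral (insert v V) (insert {u, v} E) w s
      = (LINT x | prod_space (insert v V). (deg (x w) ^ s * edge_prod E x) * U (x u) (x v))"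
    using new fin by (simp add: rooted_integral_def edge_prod_def edge_weight_kernel mult_ac)
  also have "\<dots> = (LINT x | prod_space V. deg (x w) ^ s * edge_prod E x * deg (x u))"
  proof (rule integrate_out_leaf)
    have [measurable]: "w \<in> insert v V" using V by auto
    show "(\<lambda>x. deg (x w) ^ s * edge_prod E x) \<in> borel_measurable (prod_space (insert v V))"
      using V by measurable
  qed (use fin V indep tree_edge_prod_bounds[OF T] in
      \<open>auto intro!: mult_nonneg_nonneg mult_le_one power_le_one simp: deg_nonneg deg_le_1\<close>)
  finally show ?thesis .
qed

text \<open>Induction on the number of edges, for all roots and exponents at once: AM-GM turns a
  mixed term into integrals rooted at \<open>w\<close> and at \<open>u\<close>, both with exponent
  \<open>Suc s\<close>. Structural induction on \<open>tree_on\<close> would not do, since the leaf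
  to remove depends on \<open>w\<close>.\<close>

lemma rooted_integral_le:
  fixes E :: "'i set set"
  assumes "tree_on V E" "w \<in> V"
  shows "rooted_integral V E w s \<le> expectation (\<lambda>x. deg x ^ (card E + s))"
proof -
  have "\<forall>V E w s. card E = n \<longrightarrow> tree_on V E \<longrightarrow> w \<in> V \<longrightarrow>
      rooted_integral V (E :: 'i set set) w s \<le> expectation (\<lambda>x. deg x ^ (n + s))" for n
  proof (induction n)
    case 0
    have "rooted_integral V E w s \<le> expectation (\<lambda>x. deg x ^ s)"
      if T: "tree_on V E" "w \<in> V" "card E = 0" for V w s and E :: "'i set set"
    proof -
      have "E = {}" "card V = 1" using T tree_finite[of V E] tree_card[of V E] by auto
      then have "E = {}" "V = {w}" using T by (auto simp: card_1_singleton_iff)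
      then show ?thesis by (simp add: rooted_integral_singleton)
    qed
    then show ?case by simp
  next
    case (Suc n)
    show ?case
    proof (intro allI impI)
      fix V w s and E :: "'i set set"
      assume cE: "card E = Suc n" and T: "tree_on V E" "w \<in> V"
      show "rooted_integral V E w s \<le> expectation (\<lambda>x. deg x ^ (Suc n + s))"
        using T
      proof (cases rule: tree_remove_leaf)
        case (2 V' E' u v)
        have cE': "card E' = n"
          using tree_card[OF T(1)] tree_card[OF 2(1)] tree_finite[OF 2(1)] 2 cE by simp
        have IH: "rooted_integral V' E' a (Suc s) \<le> expectation (\<lambda>x. deg x ^ (n + Suc s))"
          if "a \<in> V'" for a using Suc.IH 2(1) cE' that by blast
        have int: "integrable (prod_space V') (\<lambda>x. deg (x a) ^ Suc s * edge_prod E' x)"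
          if "a \<in> V'" for a using rooted_integrable[OF 2(1) that, of "Suc s"] by simp
        have "rooted_integral V E w s
            = (LINT x | prod_space V'. deg (x w) ^ s * edge_prod E' x * deg (x u))"
          using rooted_integral_leaf[OF 2(1-4)] 2 by simp
        \<comment> \<open>AM-GM separates \<open>deg (x w) ^ s * deg (x u)\<close> into pure powers
          at \<open>w\<close> and at \<open>u\<close>; the weights add up to 1, so the two induction
          bounds recombine without loss.\<close>
        also have "\<dots> \<le> (LINT x | prod_space V'.
            (real s / real (Suc s)) * (deg (x w) ^ Suc s * edge_prod E' x)
            + (1 / real (Suc s)) * (deg (x u) ^ Suc s * edge_prod E' x))"
        proof (rule integral_mono')
          show "integrable (prod_space V') (\<lambda>x.
              (real s / real (Suc s)) * (deg (x w) ^ Suc s * edge_prod E' x)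
              + (1 / real (Suc s)) * (deg (x u) ^ Suc s * edge_prod E' x))"
            using int 2 by (intro Bochner_Integration.integrable_add integrable_mult_right)
          fix x
          have "real (Suc s) * (deg (x w) ^ s * deg (x u))
              \<le> real s * deg (x w) ^ Suc s + deg (x u) ^ Suc s"
            by (intro power_mult_le_sum_powers deg_nonneg)
          then have "deg (x w) ^ s * deg (x u)
              \<le> (real s / real (Suc s)) * deg (x w) ^ Suc s + (1 / real (Suc s)) * deg (x u) ^ Suc s"
            by (simp add: field_simps del: power_Suc of_nat_Suc)
          from mult_right_mono[OF this tree_edge_prod_bounds(1)[OF 2(1)]]
          show "deg (x w) ^ s * edge_prod E' x * deg (x u)
              \<le> (real s / real (Suc s)) * (deg (x w) ^ Suc s * edge_prod E' x)
              + (1 / real (Suc s)) * (deg (x u) ^ Suc s * edge_prod E' x)"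
            by (simp add: algebra_simps del: power_Suc of_nat_Suc)
        next
          fix x
          show "0 \<le> (real s / real (Suc s)) * (deg (x w) ^ Suc s * edge_prod E' x)
              + (1 / real (Suc s)) * (deg (x u) ^ Suc s * edge_prod E' x)"
            using tree_edge_prod_bounds[OF 2(1)] deg_nonneg by simp
        qed
        also have "\<dots> = (real s / real (Suc s)) * rooted_integral V' E' w (Suc s)
            + (1 / real (Suc s)) * rooted_integral V' E' u (Suc s)"
          unfolding rooted_integral_def using int 2
          by (subst Bochner_Integration.integral_add) (auto simp del: power_Suc of_nat_Suc)
        also have "\<dots> \<le> (real s / real (Suc s)) * expectation (\<lambda>x. deg x ^ (n + Suc s))
            + (1 / real (Suc s)) * expectation (\<lambda>x. deg x ^ (n + Suc s))"
          using IH 2 by (intro add_mono mult_left_mono) (auto simp del: power_Suc of_nat_Suc)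
        also have "\<dots> = expectation (\<lambda>x. deg x ^ (Suc n + s))"
        proof -
          have "real s / real (Suc s) * c + 1 / real (Suc s) * c = c" for c :: real
            by (simp add: divide_simps) (simp add: algebra_simps)
          then show ?thesis by (simp only: add_Suc add_Suc_right)
        qed
        finally show ?thesis .
      qed (use cE in simp)
    qed
  qed
  from this[of "card E"] show ?thesis using assms by simp
qed

text \<open>All leaves of the star hang at the root 0, so each removal multiplies by
  \<open>deg (x 0)\<close> itself and no inequality is used.\<close>

lemma rooted_integral_star:
  "rooted_integral {0..t::nat} ((\<lambda>i. {0, i}) ` {1..t}) 0 s = expectation (\<lambda>x. deg x ^ (t + s))"
proof (induction t arbitrary: s)
  case 0
  then show ?case using rooted_integral_singleton[of 0] by simp
next
  case (Suc t)
  have "rooted_integral {0..Suc t} ((\<lambda>i. {0, i}) ` {1..Suc t}) 0 s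
     = rooted_integral {0..t} ((\<lambda>i. {0, i}) ` {1..t}) 0 (Suc s)"
    using rooted_integral_leaf[OF tree_star, of 0 t "Suc t" 0 s]
    by (simp add: rooted_integral_def atLeast0_atMost_Suc atLeastAtMostSuc_conv insert_commute mult_ac)
  then show ?case using Suc by simp
qed

lemma tree_density_le_power_star_density:
  assumes T: "tree_on V E" and E: "0 < card E" "card E \<le> t"
    and pos: "0 < (LINT x | prod_space V. edge_prod E x)"
  shows "(LINT x | prod_space V. edge_prod E x) powr (t / card E)
       \<le> (LINT x | prod_space {0..t::nat}. edge_prod ((\<lambda>i. {0, i}) ` {1..t}) x)"
proof -
  obtain w where w: "w \<in> V" using T by cases auto
  have le: "(LINT x | prod_space V. edge_prod E x) \<le> expectation (\<lambda>x. deg x ^ card E)"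
    using rooted_integral_le[OF T w, of 0] by (simp add: rooted_integral_def)
  then have "(LINT x | prod_space V. edge_prod E x) powr (t / card E)
      \<le> expectation (\<lambda>x. deg x ^ card E) powr (t / card E)"
    using pos by (intro powr_mono2) auto
  also have "\<dots> \<le> expectation (\<lambda>x. deg x ^ t)"
    using E le pos by (intro expectation_power_mono) (auto simp: deg_nonneg deg_le_1)
  also have "\<dots> = (LINT x | prod_space {0..t}. edge_prod ((\<lambda>i. {0, i}) ` {1..t}) x)"
    using rooted_integral_star[of t 0] by (simp add: rooted_integral_def)
  finally show ?thesis .
qed

end

subsection \<open>Borel versions of graphons\<close>

abbreviation unit_interval :: "real measure" where
  "unit_interval \<equiv> restrict_space lborel {0..1}"

lemma prob_space_unit_interval: "prob_space unit_interval"
  by (rule prob_space_restrict_space) auto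

lemma space_unit_interval: "space unit_interval = {0..1}"
  by (simp add: space_restrict_space)

lemma measurable_unit_intervalI: "f \<in> borel_measurable borel \<Longrightarrow> f \<in> borel_measurable unit_interval"
  by (intro measurable_restrict_space1) simp

text \<open>Preimages under the two functions differ by a subset of a null set, which is measurable
  by completeness. This supplies measurability of the integrand in
  \<open>hom_density\<close>.\<close>

lemma (in complete_measure) measurable_AE_eq:
  assumes g: "g \<in> borel_measurable M" and ae: "AE x in M. f x = g x"
  shows "f \<in> borel_measurable M"
proof (rule measurableI)
  fix A :: "'b set" assume A: "A \<in> sets borel"
  show "f -` A \<inter> space M \<in> sets M"
  proof (rule in_sets_AE)
    show "AE x in M. x \<in> g -` A \<inter> space M \<longleftrightarrow> x \<in> f -` A \<inter> space M"
      using ae by eventually_elim auto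
  qed (use g A in \<open>auto intro: measurable_sets\<close>)
qed simp

text \<open>Fubini in both directions: almost all sections of a null set \<open>N\<close> of the
  plane are null, restriction to the unit interval keeps this, and the section-wise statement is
  reassembled on the product of the restricted measures.\<close>

lemma AE_unit_square:
  assumes "AE p in lborel \<Otimes>\<^sub>M lborel. p \<in> {0..1} \<times> {0..1} \<longrightarrow> P p"
  shows "AE p in unit_interval \<Otimes>\<^sub>M unit_interval. P p"
proof -
  interpret I: prob_space unit_interval by (rule prob_space_unit_interval)
  interpret II: pair_prob_space unit_interval unit_interval ..
  obtain N where N: "\<And>p. p \<notin> N \<Longrightarrow> p \<in> {0..1} \<times> {0..1} \<longrightarrow> P p"
      "N \<in> null_sets (lborel \<Otimes>\<^sub>M lborel)"
  proof (rule AE_E3[OF assms])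
    fix N assume "\<And>p. p \<in> space (lborel \<Otimes>\<^sub>M lborel) - N \<Longrightarrow> p \<in> {0..1} \<times> {0..1} \<longrightarrow> P p"
      "N \<in> null_sets (lborel \<Otimes>\<^sub>M lborel)"
    then show thesis by (intro that[of N]) (simp_all add: space_pair_measure)
  qed
  have restr: "AE x in unit_interval. Q x" if "AE x in lborel. Q x" for Q
    by (subst AE_restrict_space_iff) (use that in \<open>simp, eventually_elim, simp\<close>)
  have "AE x in lborel. AE y in lborel. (x, y) \<notin> N"
    using lborel_pair.AE_pair[OF AE_not_in[OF N(2)]] .
  then have "AE x in lborel. AE y in unit_interval. (x, y) \<notin> N"
    by eventually_elim (rule restr)
  then have "AE x in unit_interval. AE y in unit_interval. (x, y) \<notin> N"
    by (rule restr)
  moreover have id: "(\<lambda>x. x) \<in> unit_interval \<rightarrow>\<^sub>M lborel"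
    by (rule measurable_restrict_space1) simp
  \<comment> \<open>Reassembling needs the complement of \<open>N\<close> to be measurable in the
    product of the restrictions, which follows from measurability of the inclusion.\<close>
  have 1: "(\<lambda>p. p) \<in> unit_interval \<Otimes>\<^sub>M unit_interval \<rightarrow>\<^sub>M lborel \<Otimes>\<^sub>M lborel"
    using measurable_Pair[OF measurable_compose[OF measurable_fst id] measurable_compose[OF measurable_snd id]]
    by simp
  have "{p \<in> space (unit_interval \<Otimes>\<^sub>M unit_interval). p \<notin> N} \<in> sets (unit_interval \<Otimes>\<^sub>M unit_interval)"
  proof -
    have "{p \<in> space (unit_interval \<Otimes>\<^sub>M unit_interval). p \<notin> N}
        = space (unit_interval \<Otimes>\<^sub>M unit_interval)
          - (\<lambda>p. p) -` N \<inter> space (unit_interval \<Otimes>\<^sub>M unit_interval)"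
      by blast
    also have "\<dots> \<in> sets (unit_interval \<Otimes>\<^sub>M unit_interval)"
      using N(2) by (intro sets.compl_sets measurable_sets[OF 1]) auto
    finally show ?thesis .
  qed
  ultimately have "AE p in unit_interval \<Otimes>\<^sub>M unit_interval. p \<notin> N"
    by (intro II.AE_pair_measure)
  then show ?thesis
  proof (rule AE_mp[OF _ AE_I2], intro impI)
    fix p assume "p \<in> space (unit_interval \<Otimes>\<^sub>M unit_interval)" "p \<notin> N"
    then show "P p" using N(1)[of p] by (auto simp: space_pair_measure space_unit_interval)
  qed
qed

text \<open>For distinct \<open>u\<close> and \<open>v\<close> the pair of coordinates is
  distributed as \<open>M \<Otimes>\<^sub>M M\<close>, so it almost surely avoids a null set. Equal
  indices would only give points on the diagonal, which may itself be null.\<close>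

lemma (in prob_space) AE_component_pair:
  assumes AE: "AE p in M \<Otimes>\<^sub>M M. P (fst p) (snd p)"
    and uv: "finite V" "u \<in> V" "v \<in> V" "u \<noteq> v"
  shows "AE x in Pi\<^sub>M V (\<lambda>_. M). P (x u) (x v)"
proof -
  interpret product_prob_space "\<lambda>_. M" V by unfold_locales
  let ?r = "\<lambda>x. restrict x {u, v}"
  obtain N where N: "\<And>p. p \<in> space (M \<Otimes>\<^sub>M M) - N \<Longrightarrow> P (fst p) (snd p)" "N \<in> null_sets (M \<Otimes>\<^sub>M M)"
    using AE by (rule AE_E3) blast
  then have [measurable]: "N \<in> sets (M \<Otimes>\<^sub>M M)" by auto
  have "(\<integral>\<^sup>+ x. indicator N (x u, x v) \<partial>Pi\<^sub>M {u, v} (\<lambda>_. M)) = (\<integral>\<^sup>+ p. indicator N p \<partial>(M \<Otimes>\<^sub>M M))"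
    using product_nn_integral_pair[of "\<lambda>a b. indicator N (a, b)" u v] uv by simp
  also have "\<dots> = 0" using N by auto
  finally have 0: "(\<integral>\<^sup>+ x. indicator N (x u, x v) \<partial>Pi\<^sub>M {u, v} (\<lambda>_. M)) = 0" .
  have dist: "distr (Pi\<^sub>M V (\<lambda>_. M)) (Pi\<^sub>M {u, v} (\<lambda>_. M)) ?r = Pi\<^sub>M {u, v} (\<lambda>_. M)"
    using uv by (intro distr_PiM_restrict_finite) auto
  have "AE x in Pi\<^sub>M {u, v} (\<lambda>_. M). (x u, x v) \<notin> N"
    using 0 by (subst (asm) nn_integral_0_iff_AE) (auto simp: indicator_def split: if_splits)
  then have "AE x in distr (Pi\<^sub>M V (\<lambda>_. M)) (Pi\<^sub>M {u, v} (\<lambda>_. M)) ?r. (x u, x v) \<notin> N"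
    unfolding dist .
  from AE_distrD[OF measurable_restrict_subset this] uv
  have "AE x in Pi\<^sub>M V (\<lambda>_. M). (?r x u, ?r x v) \<notin> N" by simp
  then show ?thesis
  proof (rule AE_mp[OF _ AE_I2], intro impI)
    fix x assume x: "x \<in> space (Pi\<^sub>M V (\<lambda>_. M))" "(?r x u, ?r x v) \<notin> N"
    then have "(x u, x v) \<in> space (M \<Otimes>\<^sub>M M)"
      using uv by (auto simp: space_PiM space_pair_measure)
    then show "P (x u) (x v)" using N(1)[of "(x u, x v)"] x(2) by auto
  qed
qed

text \<open>A Lebesgue measurable function agrees almost everywhere with a Borel one
  \<open>g\<close>; symmetrising and truncating \<open>g\<close> restores symmetry and bounds at
  every point.\<close>

lemma graphon_borel_version:
  assumes "graphon W"
  obtains U where "symmetric_kernel unit_interval U"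
    "AE p in unit_interval \<Otimes>\<^sub>M unit_interval. W (fst p) (snd p) = U (fst p) (snd p)"
proof -
  let ?Q = "{0..1} \<times> {0..1} :: (real \<times> real) set"
  have W: "case_prod W \<in> borel_measurable (lebesgue_on ?Q)"
      "\<And>x y. x \<in> {0..1} \<Longrightarrow> y \<in> {0..1} \<Longrightarrow> W x y = W y x \<and> 0 \<le> W x y \<and> W x y \<le> 1"
    using assms by (auto simp: graphon_def)
  have "(\<lambda>p. if p \<in> ?Q then case_prod W p else 0) \<in> borel_measurable lebesgue"
    using W(1) by (intro borel_measurable_if_I sets_completionI_sets) (auto intro!: borel_closed closed_Times)
  then obtain g where g: "g \<in> borel_measurable lborel"
      "AE p in lborel. (if p \<in> ?Q then case_prod W p else 0) = g p"
    using completion_ex_borel_measurable_real by blast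
  have gb [measurable]: "g \<in> borel_measurable (borel \<Otimes>\<^sub>M borel)" using g(1) by (simp add: borel_prod)
  \<comment> \<open>Wherever \<open>g\<close> equals \<open>W\<close> at both \<open>(x, y)\<close>
    and \<open>(y, x)\<close> in the square, averaging and truncation change nothing, as
    \<open>W\<close> is symmetric with values in \<open>[0, 1]\<close>.\<close>
  define U where "U x y = max 0 (min 1 ((g (x, y) + g (y, x)) / 2))" for x y
  have "symmetric_kernel unit_interval U"
  proof (intro symmetric_kernel.intro prob_space_unit_interval symmetric_kernel_axioms.intro)
    have [measurable]: "(\<lambda>x. x) \<in> borel_measurable unit_interval" by (rule measurable_unit_intervalI) simp
    have "case_prod U \<in> borel_measurable (borel \<Otimes>\<^sub>M borel)" unfolding U_def by measurable
    moreover have "id \<in> unit_interval \<Otimes>\<^sub>M unit_interval \<rightarrow>\<^sub>M borel \<Otimes>\<^sub>M borel"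
      unfolding id_def by (rule measurable_pair) (auto simp: comp_def)
    ultimately show "case_prod U \<in> borel_measurable (unit_interval \<Otimes>\<^sub>M unit_interval)"
      using measurable_compose by (fastforce simp: id_def)
  qed (auto simp: U_def add.commute)
  moreover have "AE p in unit_interval \<Otimes>\<^sub>M unit_interval. W (fst p) (snd p) = U (fst p) (snd p)"
  proof -
    have 1: "AE p in lborel \<Otimes>\<^sub>M lborel. p \<in> ?Q \<longrightarrow> case_prod W p = g p"
      unfolding lborel_prod using g(2) by eventually_elim auto
    \<comment> \<open>The reflection in the diagonal preserves Lebesgue measure, so \<open>g\<close>
      also agrees with \<open>W\<close> at almost every reflected point.\<close>
    have "AE p in lborel \<Otimes>\<^sub>M lborel. (snd p, fst p) \<in> ?Q \<longrightarrow> case_prod W (snd p, fst p) = g (snd p, fst p)"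
    proof -
      have "AE p in distr (lborel \<Otimes>\<^sub>M lborel) (lborel \<Otimes>\<^sub>M lborel) (\<lambda>(x, y). (y, x)).
          p \<in> ?Q \<longrightarrow> case_prod W p = g p"
        using 1 unfolding lborel_pair.distr_pair_swap[symmetric] .
      from AE_distrD[OF _ this] show ?thesis by (auto simp: case_prod_beta)
    qed
    with 1 have "AE p in lborel \<Otimes>\<^sub>M lborel. p \<in> ?Q \<longrightarrow> W (fst p) (snd p) = U (fst p) (snd p)"
    proof eventually_elim
      case (elim p)
      show ?case
      proof
        assume p: "p \<in> ?Q"
        then have "W (fst p) (snd p) = g (fst p, snd p)" "W (snd p) (fst p) = g (snd p, fst p)"
          using elim by auto
        moreover have "W (snd p) (fst p) = W (fst p) (snd p)" "0 \<le> W (fst p) (snd p)" "W (fst p) (snd p) \<le> 1"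
          using p W(2) by auto
        ultimately show "W (fst p) (snd p) = U (fst p) (snd p)" by (simp add: U_def)
      qed
    qed
    then show ?thesis by (rule AE_unit_square)
  qed
  ultimately show ?thesis by (rule that)
qed

lemma hom_density_borel_version:
  assumes G: "pair_graph G" and W: "graphon W"
    and U: "symmetric_kernel unit_interval U"
    and AE: "AE p in unit_interval \<Otimes>\<^sub>M unit_interval. W (fst p) (snd p) = U (fst p) (snd p)"
  shows "hom_density G W
       = (LINT x | Pi\<^sub>M (pverts G) (\<lambda>_. unit_interval). symmetric_kernel.edge_prod U (edges G) x)"
proof -
  interpret U: symmetric_kernel unit_interval U by fact
  interpret G: pair_graph G by fact
  let ?P = "Pi\<^sub>M (pverts G) (\<lambda>_. unit_interval)"
  have meas: "U.edge_prod (edges G) \<in> borel_measurable ?P"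
    by (rule U.edge_prod_measurable) (blast elim: edgesE[OF G])
  have "AE x in ?P. \<forall>e\<in>edges G. edge_weight W x e = edge_weight U x e"
  proof (intro AE_finite_allI finite_edges[OF G])
    fix e assume "e \<in> edges G"
    then obtain u v where e: "e = {u, v}" "u \<in> pverts G" "v \<in> pverts G" "u \<noteq> v"
      by (rule edgesE[OF G])
    have "AE x in ?P. W (x u) (x v) = U (x u) (x v)"
      using U.AE_component_pair[OF AE _ e(2-4)] by simp
    then show "AE x in ?P. edge_weight W x e = edge_weight U x e"
    proof (rule AE_mp[OF _ AE_I2], intro impI)
      fix x assume x: "x \<in> space ?P" "W (x u) (x v) = U (x u) (x v)"
      then have "x u \<in> {0..1}" "x v \<in> {0..1}"
        using e by (auto simp: space_PiM space_unit_interval PiE_iff)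
      \<comment> \<open>Symmetry of \<open>W\<close> is known only on the unit square; it makes the
        description in \<open>edge_weight\<close> proper at this point.\<close>
      then have "W (x u) (x v) = W (x v) (x u)" using W by (auto simp: graphon_def)
      then show "edge_weight W x e = edge_weight U x e"
        using x(2) unfolding e(1) U.edge_weight_kernel by (simp add: edge_weight_eq)
    qed
  qed
  then have AE': "AE x in ?P. (\<Prod>e\<in>edges G. edge_weight W x e) = U.edge_prod (edges G) x"
    by eventually_elim (simp add: U.edge_prod_def)
  have mU: "U.edge_prod (edges G) \<in> borel_measurable (completion ?P)"
    using meas by (rule measurable_completion)
  have "hom_density G W = (LINT x | completion ?P. U.edge_prod (edges G) x)"
    unfolding hom_density_def
  proof (rule integral_cong_AE)
    show "AE x in completion ?P. (\<Prod>e\<in>edges G. edge_weight W x e) = U.edge_prod (edges G) x"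
      using AE' by (rule AE_completion)
    then show "(\<lambda>x. \<Prod>e\<in>edges G. edge_weight W x e) \<in> borel_measurable (completion ?P)"
      by (rule completion.measurable_AE_eq[OF mU])
  qed (rule mU)
  also have "\<dots> = (LINT x | ?P. U.edge_prod (edges G) x)"
    using meas by (rule integral_completion)
  finally show ?thesis .
qed

section \<open>Bounds for the densities of a graphon\<close>

lemma hom_density_bounds:
  assumes G: "pair_graph G" and W: "graphon W"
  shows "0 \<le> hom_density G W" "hom_density G W \<le> 1"
proof -
  obtain U where U: "symmetric_kernel unit_interval U"
    and AE: "AE p in unit_interval \<Otimes>\<^sub>M unit_interval. W (fst p) (snd p) = U (fst p) (snd p)"
    using graphon_borel_version[OF W] .
  interpret U: symmetric_kernel unit_interval U by fact
  interpret P: prob_space "U.prod_space (pverts G)" by (rule U.prob_space_prod_space)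
  have bd: "0 \<le> U.edge_prod (edges G) x \<and> U.edge_prod (edges G) x \<le> 1" for x
    by (rule U.edge_prod_bounds) (blast elim: edgesE[OF G])
  have meas: "U.edge_prod (edges G) \<in> borel_measurable (U.prod_space (pverts G))"
    by (rule U.edge_prod_measurable) (blast elim: edgesE[OF G])
  have int: "integrable (U.prod_space (pverts G)) (U.edge_prod (edges G))"
    using meas bd by (intro U.integrable_prod_space) auto
  show "0 \<le> hom_density G W" "hom_density G W \<le> 1"
    unfolding hom_density_borel_version[OF G W U AE]
    using bd int by (auto intro!: integral_nonneg P.integral_le_const)
qed

lemma pair_graph_star: "pair_graph (star t)"
  by unfold_locales (auto simp: star_def symmetric_def sym_def arcs_ends_conv)

lemma hom_density_powr_le_star:
  assumes G: "pair_graph G" and W: "graphon W"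
    and T: "tree_on (pverts G) E" "E \<subseteq> edges G" and E: "0 < card E" "card E \<le> t"
    and pos: "0 < hom_density G W"
  shows "hom_density G W powr (t / card E) \<le> hom_density (star t) W"
proof -
  obtain U where U: "symmetric_kernel unit_interval U"
    and AE: "AE p in unit_interval \<Otimes>\<^sub>M unit_interval. W (fst p) (snd p) = U (fst p) (snd p)"
    using graphon_borel_version[OF W] .
  interpret U: symmetric_kernel unit_interval U by fact
  note dens = hom_density_borel_version[OF _ W U AE]
  \<comment> \<open>The edges outside the spanning tree contribute a factor of at most 1.\<close>
  have le: "U.edge_prod (edges G) x \<le> U.edge_prod E x" for x
  proof -
    have "U.edge_prod (edges G) x = U.edge_prod (edges G - E) x * U.edge_prod E x"
      unfolding U.edge_prod_def by (rule prod.subset_diff[OF T(2) finite_edges[OF G]])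
    also have "\<dots> \<le> 1 * U.edge_prod E x"
    proof (rule mult_right_mono)
      show "U.edge_prod (edges G - E) x \<le> 1"
        using U.edge_prod_bounds[of "edges G - E" x] edgesE[OF G] by blast
    qed (rule U.tree_edge_prod_bounds[OF T(1)])
    finally show ?thesis by simp
  qed
  have le': "hom_density G W \<le> (LINT x | U.prod_space (pverts G). U.edge_prod E x)"
    unfolding dens[OF G]
  proof (rule integral_mono')
    show "integrable (U.prod_space (pverts G)) (U.edge_prod E)"
      using U.tree_edge_prod_bounds[OF T(1)] U.tree_edge_prod_measurable[OF T(1)]
      by (intro U.integrable_prod_space) auto
  qed (use le U.tree_edge_prod_bounds[OF T(1)] in auto)
  with pos have pos': "0 < (LINT x | U.prod_space (pverts G). U.edge_prod E x)" by simp
  from le' have "hom_density G W powr (t / card E)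
      \<le> (LINT x | U.prod_space (pverts G). U.edge_prod E x) powr (t / card E)"
    using pos by (intro powr_mono2) auto
  also have "\<dots> \<le> (LINT x | U.prod_space {0..t}. U.edge_prod ((\<lambda>i. {0, i}) ` {1..t}) x)"
    using pos' by (rule U.tree_density_le_power_star_density[OF T(1) E])
  finally show ?thesis
    using dens[OF pair_graph_star, of t] by (simp add: edges_star) (simp add: star_def)
qed

subsection \<open>The disjoint union of two cliques\<close>

text \<open>The graphon of two isolated looped vertices: both halves of the interval are complete,
  diagonal included, with nothing between them.\<close>

definition two_cliques :: "real \<Rightarrow> real \<Rightarrow> real" where
  "two_cliques x y = (if x \<le> 1/2 \<longleftrightarrow> y \<le> 1/2 then 1 else 0)"

lemma two_cliques_measurable: "case_prod two_cliques \<in> borel_measurable (borel \<Otimes>\<^sub>M borel)"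
  unfolding two_cliques_def by measurable

lemma graphon_two_cliques: "graphon two_cliques"
proof -
  have "case_prod two_cliques \<in> borel_measurable lborel"
    using two_cliques_measurable by (simp add: borel_prod)
  then have "case_prod two_cliques \<in> borel_measurable (lebesgue_on ({0..1} \<times> {0..1}))"
    by (intro measurable_restrict_space1 measurable_completion)
  then show ?thesis unfolding graphon_def by (auto simp: two_cliques_def)
qed

lemma symmetric_kernel_two_cliques: "symmetric_kernel unit_interval two_cliques"
proof (intro symmetric_kernel.intro prob_space_unit_interval symmetric_kernel_axioms.intro)
  have "(\<lambda>x. x) \<in> borel_measurable unit_interval" by (rule measurable_unit_intervalI) simp
  then have "(\<lambda>p. (fst p, snd p)) \<in> unit_interval \<Otimes>\<^sub>M unit_interval \<rightarrow>\<^sub>M borel \<Otimes>\<^sub>M borel"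
    by (intro measurable_Pair measurable_compose[OF measurable_fst] measurable_compose[OF measurable_snd])
  from measurable_compose[OF this two_cliques_measurable]
  show "case_prod two_cliques \<in> borel_measurable (unit_interval \<Otimes>\<^sub>M unit_interval)"
    by (simp add: case_prod_beta)
qed (auto simp: two_cliques_def)

text \<open>The product over the edges is 1 if all vertices fall in the same half and 0 otherwise,
  by connectedness. These are two disjoint events, each of probability
  \<open>1 / 2 ^ card (pverts G)\<close> by independence.\<close>

lemma hom_density_two_cliques:
  assumes G: "pair_graph G" and T: "tree_on (pverts G) E" "E \<subseteq> edges G"
  shows "hom_density G two_cliques = 2 / 2 ^ card (pverts G)"
proof -
  interpret U: symmetric_kernel unit_interval two_cliques by (rule symmetric_kernel_two_cliques)
  let ?V = "pverts G"
  let ?A = "{..1/2} :: real set" and ?B = "{1/2<..} :: real set"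
  have V: "finite ?V" "?V \<noteq> {}" using tree_finite[OF T(1)] tree_card[OF T(1)] by auto
  have split: "U.edge_prod (edges G) x
      = (\<Prod>v\<in>?V. indicator ?A (x v)) + (\<Prod>v\<in>?V. indicator ?B (x v))" for x
  proof (cases "\<forall>u v. {u, v} \<in> edges G \<longrightarrow> (x u \<le> 1/2 \<longleftrightarrow> x v \<le> 1/2)")
    case True
    then obtain c where c: "\<forall>v\<in>?V. (x v \<le> 1/2) = c"
      using tree_eq_const[OF T(1), of "\<lambda>v. x v \<le> 1/2"] T(2) by blast
    have "edge_weight two_cliques x e = 1" if e: "e \<in> edges G" for e
    proof -
      obtain u v where "e = {u, v}" using edgesE[OF G e] by metis
      then show ?thesis using True e by (auto simp: U.edge_weight_kernel two_cliques_def)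
    qed
    then have "U.edge_prod (edges G) x = 1" by (simp add: U.edge_prod_def)
    moreover have "(\<Prod>v\<in>?V. indicator ?A (x v)) = (\<Prod>v\<in>?V. if c then 1 else 0 :: real)"
      "(\<Prod>v\<in>?V. indicator ?B (x v)) = (\<Prod>v\<in>?V. if c then 0 else 1 :: real)"
      by (rule prod.cong; use c in force)+
    \<comment> \<open>Since \<open>?V\<close> is nonempty, exactly one of the two products is 1 and
      the other is 0.\<close>
    ultimately show ?thesis using V by (cases c) (simp_all add: power_0_left card_gt_0_iff)
  next
    case False
    then obtain u v where uv: "{u, v} \<in> edges G" "(x u \<le> 1/2) \<noteq> (x v \<le> 1/2)" by blast
    then have "u \<in> ?V" "v \<in> ?V" using edgesE[OF G uv(1)] by (metis doubleton_eq_iff)+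
    \<comment> \<open>The violated edge has an endpoint in each half; one endpoint kills each
      product of indicators.\<close>
    then obtain a b where "a \<in> ?V" "1/2 < x a" "b \<in> ?V" "x b \<le> 1/2"
      using uv(2) by (metis not_le)
    then have "(\<Prod>v\<in>?V. indicator ?A (x v)) = (0::real)" "(\<Prod>v\<in>?V. indicator ?B (x v)) = (0::real)"
      by (intro prod_zero[OF V(1)] bexI[of _ a] bexI[of _ b]; simp)+
    moreover have "U.edge_prod (edges G) x = 0"
      unfolding U.edge_prod_def using uv finite_edges[OF G]
      by (auto intro!: prod_zero bexI[of _ "{u, v}"] simp: U.edge_weight_kernel two_cliques_def)
    ultimately show ?thesis by simp
  qed
  have int: "integrable unit_interval (indicator A :: real \<Rightarrow> real)" if "A \<in> sets borel" for A
    using that by (intro U.integrable_const_bound[where B = 1])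
      (auto intro!: measurable_unit_intervalI)
  have half: "(LINT x | unit_interval. indicator ?A x) = (1/2 :: real)"
    "(LINT x | unit_interval. indicator ?B x) = (1/2 :: real)"
  proof -
    have "?A \<inter> space unit_interval = {0..1/2}" "?B \<inter> space unit_interval = {1/2<..1}"
      "{1/2<..1} \<subseteq> {0..1::real}"
      by (auto simp: space_unit_interval)
    then show "(LINT x | unit_interval. indicator ?A x) = (1/2 :: real)"
      "(LINT x | unit_interval. indicator ?B x) = (1/2 :: real)"
      by (simp_all add: measure_restrict_space)
  qed
  have "hom_density G two_cliques = (LINT x | U.prod_space ?V. U.edge_prod (edges G) x)"
    by (rule hom_density_borel_version[OF G graphon_two_cliques symmetric_kernel_two_cliques]) simp
  also have "\<dots> = (LINT x | U.prod_space ?V. (\<Prod>v\<in>?V. indicator ?A (x v)))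
      + (LINT x | U.prod_space ?V. (\<Prod>v\<in>?V. indicator ?B (x v)))"
    unfolding split using V int
    by (intro Bochner_Integration.integral_add U.product_integrable_prod) auto
  also have "\<dots> = 2 / 2 ^ card ?V"
    using U.product_integral_prod[of ?V "\<lambda>_. indicator ?A :: real \<Rightarrow> real"]
      U.product_integral_prod[of ?V "\<lambda>_. indicator ?B :: real \<Rightarrow> real"] V int
    unfolding half prod_constant by (simp add: power_one_over)
  finally show ?thesis .
qed

subsection \<open>The density domination exponent of a star\<close>

theorem proposition3p1:
  fixes t :: nat and G :: "'a pair_pre_digraph"
  assumes "t > 0"
    and "pair_graph G"
    and "Digraph_Component.connected (with_proj G)"
    and "2 \<le> card (pverts G)"
    and "card (pverts G) \<le> t + 1"
  shows "density_domination_exponent G (star t) =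
           ennreal (real t / (real (card (pverts G)) - 1))"
proof -
  note G = \<open>pair_graph G\<close>
  obtain E where T: "tree_on (pverts G) E" "E \<subseteq> edges G"
    using spanning_tree_exists[OF G assms(3)] .
  define k where "k = card E"
  have card: "card (pverts G) = Suc k" using tree_card[OF T(1)] by (simp add: k_def)
  then have k: "0 < k" "k \<le> t" using assms by auto
  show ?thesis unfolding density_domination_exponent_def card
  \<comment> \<open>Every graphon gives a quotient of at most \<open>t / k\<close>, and
    \<open>two_cliques\<close> attains it.\<close>
  proof (rule antisym[OF SUP_least SUP_upper2[where i = two_cliques]])
    fix W assume "W \<in> {W. graphon W \<and> hom_density G W \<noteq> 0 \<and> hom_density G W \<noteq> 1}"
    then have W: "graphon W" "hom_density G W \<noteq> 0" "hom_density G W \<noteq> 1" by auto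
    let ?a = "hom_density G W" and ?b = "hom_density (star t) W"
    have a: "0 < ?a" "?a < 1" using W hom_density_bounds[OF G W(1)] by auto
    have le: "?a powr (t / k) \<le> ?b"
      using hom_density_powr_le_star[OF G W(1) T, of t] k a by (simp add: k_def)
    have "0 < ?a powr (t / k)" using a by simp
    \<comment> \<open>Positivity of the star density rules out the quotient
      \<open>\<infinity>\<close>.\<close>
    with le have b: "0 < ?b" "?b \<le> 1"
      using hom_density_bounds[OF pair_graph_star W(1), of t] by linarith+
    have "t / k * ln ?a \<le> ln ?b"
      using le a b by (metis ln_mono ln_powr powr_gt_zero less_irrefl)
    \<comment> \<open>The logarithm of \<open>?a\<close> is negative, so dividing by it reverses the
      inequality.\<close>
    then have "ln ?b / ln ?a \<le> t / k" using a by (simp add: neg_divide_le_eq)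
    then show "e2ennreal (ext_ln ?b / ext_ln ?a) \<le> ennreal (real t / (real (Suc k) - 1))"
      using ext_ln_quotient(1)[of ?a ?b] a b by (simp add: ennreal_leI)
  next
    have dG: "hom_density G two_cliques = 1 / 2 ^ k"
      using hom_density_two_cliques[OF G T] card by simp
    \<comment> \<open>The star serves as its own spanning tree.\<close>
    have "hom_density (star t) two_cliques = 2 / 2 ^ card (pverts (star t))"
      by (rule hom_density_two_cliques[OF pair_graph_star, where E = "edges (star t)"])
        (use tree_star[of t] in \<open>simp_all add: edges_star\<close>, simp add: star_def)
    then have dS: "hom_density (star t) two_cliques = 1 / 2 ^ t" by (simp add: star_def)
    have "(1::real) < 2 ^ k" using k by simp
    then show "two_cliques \<in> {W. graphon W \<and> hom_density G W \<noteq> 0 \<and> hom_density G W \<noteq> 1}"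
      using graphon_two_cliques dG by simp
    have "ext_ln (1 / 2 ^ t) / ext_ln (1 / 2 ^ k) = ereal (ln (1 / 2 ^ t) / ln (1 / 2 ^ k))"
      using \<open>1 < 2 ^ k\<close> by (subst ext_ln_quotient(1)) auto
    also have "ln (1 / 2 ^ t) / ln (1 / 2 ^ k) = t / k"
      using k by (simp add: ln_div ln_realpow)
    finally show "ennreal (real t / (real (Suc k) - 1))
        \<le> e2ennreal (ext_ln (hom_density (star t) two_cliques) / ext_ln (hom_density G two_cliques))"
      unfolding dG dS by simp
  qed
qed

end
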